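(* Let $I$ be the hypercube of 5-tuples in $]0,1[^5$ and let $\mathcal U$ be an arbitrary but fixed open domain containing it. The following differential relation is identically satisfied on $\mathcal U$: $$\sum_{i=1}^{10}\epsilon_i\,U_i^*(\Omega)=0 .$$ Consequently, the 10-tuple $\big(\epsilon_iU_i^*(\Omega)\big)_{i=1}^{10}$ can be seen as a 2-abelian relation (again denoted $\mathbf{HLOG}_{\boldsymbol Y_5}$) for the web $\boldsymbol W^{GM}_{\boldsymbol Y_5}$ with first integrals $U_1,\dots,U_{10}$.
   Context: On $\mathbf C^5$ with coordinates $y_{13},y_{14},y_{24},y_{25},y_{35}$ put $P_1=1+y_{25}-y_{24}y_{35}$, $P_2=1+y_{13}-y_{14}y_{35}$, $P_3=1+y_{24}-y_{14}y_{25}$, $P_4=1+y_{35}-y_{13}y_{25}$, $P_5=1+y_{14}-y_{13}y_{24}$. Consider the rational maps $U_i=(U_{i,1},U_{i,2})$: $U_1=(y_{25},y_{24}y_{35})$, $U_2=(\frac1{y_{13}},\frac{y_{14}y_{35}}{y_{13}})$, $U_3=(y_{24},y_{14}y_{25})$, $U_4=(\frac1{y_{35}},\frac{y_{13}y_{25}}{y_{35}})$, $U_5=(y_{14},y_{13}y_{24})$, $U_6=(\frac{P_2}{y_{14}P_4},\frac{y_{13}P_3}{y_{14}P_4})$, $U_7=(\frac{P_1}{y_{24}P_4},\frac{P_3}{y_{24}P_4})$, $U_8=(\frac{y_{13}P_1}{P_4},\frac{P_2}{P_4})$, $U_9=(\frac{y_{14}P_1}{P_3},\frac{y_{24}P_2}{P_3})$,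 $U_{10}=(\frac{P_1}{y_{35}P_3},\frac{y_{25}P_2}{y_{35}P_3})$. Set $U_{i,3}=1+U_{i,1}-U_{i,2}$, $(\epsilon_i)_{i=1}^{10}=(1,-1,1,-1,1,1,-1,1,-1,1)$, and with $u_3=1+u_1-u_2$, $$\Omega=\ln u_1\,\frac{du_2\wedge du_3}{u_2u_3}-\ln u_2\,\frac{du_1\wedge du_3}{u_1u_3}+\ln u_3\,\frac{du_1\wedge du_2}{u_1u_2},$$ so that $U_i^*\Omega$ is obtained by substituting $u_s=U_{i,s}$. Here $\ln$ is the usual complex logarithm (the primitive vanishing at $1$ of $du/u$ on $\mathbf C^*$). On $I$ the five polynomials $P_1,\dots,P_5$, hence all the $U_{i,s}$ ($i=1,\dots,10$, $s=1,2,3$), are positive. Because of the logarithms, the resulting abelian relation is not global but multivalued, with additive monodromy. A 2-abelian relation of the web is a tuple $(\eta_i)$ with $\eta_i$ the pull-back under $U_i$ of a 2-form and $\sum_i\eta_i=0$. *)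

theory Defs
  imports "HOL-Analysis.Analysis"
begin

text \<open>
  Conventions. The logarithms make the forms multivalued, so a multivalued differential 2-form is
  represented by its determinations: it assigns to a path \<open>\<gamma>\<close>, issued from a fixed base set, the
  value at the end point of \<open>\<gamma>\<close> of the determination continued along \<open>\<gamma>\<close>. This value is a
  bilinear form on tangent vectors.
\<close>

type_synonym 'n form1 = "complex^'n \<Rightarrow> complex^'n \<Rightarrow> complex"
type_synonym 'n form2 = "complex^'n \<Rightarrow> complex^'n \<Rightarrow> complex^'n \<Rightarrow> complex"
type_synonym 'n multiform2 = "(real \<Rightarrow> complex^'n) \<Rightarrow> complex^'n \<Rightarrow> complex^'n \<Rightarrow> complex"


subsection \<open>Differential 2-forms and their analytic continuation\<close>

definition differential :: "(complex^'n \<Rightarrow> complex) \<Rightarrow> 'n form1"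
  where "differential f x = frechet_derivative f (at x)"

definition wedge :: "'n form1 \<Rightarrow> 'n form1 \<Rightarrow> 'n form2"
  where "wedge \<alpha> \<beta> x v w = \<alpha> x v * \<beta> x w - \<alpha> x w * \<beta> x v"

definition holomorphic_2form :: "(complex^'n) set \<Rightarrow> 'n form2 \<Rightarrow> bool"
  where "holomorphic_2form S \<theta> \<longleftrightarrow> open S \<and>
    (\<forall>x\<in>S. \<forall>v. Vector_Spaces.linear (*s) (*) (\<theta> x v) \<and>
       Vector_Spaces.linear (*s) (*) (\<lambda>w. \<theta> x w v) \<and> \<theta> x v v = 0) \<and>
    (\<forall>v w. \<forall>x\<in>S. \<exists>D. Vector_Spaces.linear (*s) (*) D \<and>
       ((\<lambda>x. \<theta> x v w) has_derivative D) (at x))"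

text \<open>The paths along which multivalued forms on \<open>X\<close> with base set \<open>B\<close> are continued.\<close>

definition based_path :: "(complex^'n) set \<Rightarrow> (complex^'n) set \<Rightarrow> (real \<Rightarrow> complex^'n) \<Rightarrow> bool"
  where "based_path X B \<gamma> \<longleftrightarrow> path \<gamma> \<and> path_image \<gamma> \<subseteq> X \<and> pathstart \<gamma> \<in> B"

text \<open>
  \<open>\<omega>\<close> is obtained from a single-valued holomorphic 2-form \<open>\<omega>0\<close> on a neighbourhood of \<open>B\<close> by analytic
  continuation along all paths in \<open>X\<close> issued from \<open>B\<close>; \<open>\<theta> t\<close> is the continuation at time \<open>t\<close>.
\<close>

definition multivalued_2form ::
    "(complex^'n) set \<Rightarrow> (complex^'n) set \<Rightarrow> 'n multiform2 \<Rightarrow> bool"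
  where "multivalued_2form X B \<omega> \<longleftrightarrow>
    (\<exists>N \<omega>0. B \<subseteq> N \<and> holomorphic_2form N \<omega>0 \<and>
      (\<forall>\<delta>. based_path X B \<delta> \<longrightarrow>
        (\<exists>V \<theta>. (\<forall>t\<in>{0..1}. \<delta> t \<in> V t \<and> holomorphic_2form (V t) (\<theta> t)) \<and>
          (\<forall>\<^sub>F x in nhds (\<delta> 0). \<theta> 0 x = \<omega>0 x) \<and>
          (\<forall>t\<in>{0..1}. \<forall>\<^sub>F s in at t within {0..1}. \<forall>\<^sub>F x in nhds (\<delta> s). \<theta> s x = \<theta> t x) \<and>
          \<omega> \<delta> = \<theta> 1 (\<delta> 1))))"

definition pullback :: "(complex^'n \<Rightarrow> complex^'m) \<Rightarrow> 'm multiform2 \<Rightarrow> 'n multiform2"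
  where "pullback F \<omega> \<gamma> v w =
    (let dF = frechet_derivative F (at (pathfinish \<gamma>)) in \<omega> (F \<circ> \<gamma>) (dF v) (dF w))"

text \<open>
  Multivalued 2-abelian relations on \<open>M\<close>, with base set \<open>B\<close>, of the web with first integrals \<open>W i\<close>,
  \<open>i \<in> J\<close>.
\<close>

definition abelian_relation_2 ::
    "(complex^'n) set \<Rightarrow> (complex^'n) set \<Rightarrow> 'i set \<Rightarrow> ('i \<Rightarrow> complex^'n \<Rightarrow> complex^'m)
      \<Rightarrow> ('i \<Rightarrow> 'n multiform2) \<Rightarrow> bool"
  where "abelian_relation_2 M B J W \<eta> \<longleftrightarrow>
    (\<forall>i\<in>J. \<exists>X \<omega>. open X \<and> W i ` M \<subseteq> X \<and> multivalued_2form X (W i ` B) \<omega> \<and>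
      (\<forall>\<gamma>. based_path M B \<gamma> \<longrightarrow> \<eta> i \<gamma> = pullback (W i) \<omega> \<gamma>)) \<and>
    (\<forall>\<gamma>. based_path M B \<gamma> \<longrightarrow> (\<forall>v w. (\<Sum>i\<in>J. \<eta> i \<gamma> v w) = 0))"


subsection \<open>The logarithm along a path and the form \<open>\<Omega>\<close>\<close>

text \<open>
  The value at the end of the path \<open>g\<close> of the logarithm continued along \<open>g\<close>, starting with the
  principal determination (the one that vanishes at 1). It is only used for paths in \<open>- {0}\<close> that
  start on the positive real axis.
\<close>

definition ln_along :: "(real \<Rightarrow> complex) \<Rightarrow> complex"
  where "ln_along g = (THE c. \<exists>l. continuous_on {0..1} l \<and> l 0 = ln (g 0) \<and>
    (\<forall>t\<in>{0..1}. exp (l t) = g t) \<and> l 1 = c)"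

lemma norm_ge_2pi_if_exp_eq_1:
  fixes z :: complex
  assumes "exp z = 1" "z \<noteq> 0"
  shows "2 * pi \<le> norm z"
proof -
  obtain n :: int where n: "Re z = 0" "Im z = of_int (2 * n) * pi"
    using assms(1) exp_eq_1[of z] by blast
  have "n \<noteq> 0"
    using n assms(2) complex_eqI[of z 0] by fastforce
  then have "1 \<le> \<bar>real_of_int n\<bar>" by linarith
  then have "2 * pi \<le> \<bar>Im z\<bar>"
    unfolding n(2) by (simp add: abs_mult)
  also have "\<dots> \<le> norm z" by (rule abs_Im_le_cmod)
  finally show ?thesis .
qed

lemma ln_along_eqI:
  assumes l: "continuous_on {0..1} l" "l 0 = ln (g 0)" "\<And>t. t \<in> {0..1} \<Longrightarrow> exp (l t) = g t"
  shows "ln_along g = l 1"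
proof -
  have "m 1 = l 1" if m: "continuous_on {0..1} m" "m 0 = ln (g 0)"
    "\<forall>t\<in>{0..1}. exp (m t) = g t" for m
  proof -
    define d where "d t = m t - l t" for t
    have exp_d: "exp (d t) = 1" if "t \<in> {0..1}" for t
    proof -
      have "exp (m t) = exp (l t)" using l(3)[OF that] m(3) that by metis
      then show ?thesis unfolding d_def exp_diff by simp
    qed
    have "d constant_on {0..1}"
    proof (rule continuous_discrete_range_constant)
      show "continuous_on {0..1} d"
        unfolding d_def using l(1) m(1) by (intro continuous_intros)
      fix x :: real assume x: "x \<in> {0..1}"
      have "2 * pi \<le> norm (d y - d x)" if "y \<in> {0..1}" "d y \<noteq> d x" for y
        by (rule norm_ge_2pi_if_exp_eq_1) (use that x exp_d in \<open>simp_all add: exp_diff\<close>)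
      then show "\<exists>e>0. \<forall>y. y \<in> {0..1} \<and> d y \<noteq> d x \<longrightarrow> e \<le> norm (d y - d x)"
        using pi_gt_zero by (intro exI[of _ "2 * pi"] conjI) simp_all
    qed simp
    then obtain c where "\<And>t. t \<in> {0..1} \<Longrightarrow> d t = c"
      unfolding constant_on_def by blast
    from this[of 0] this[of 1] have "d 1 = d 0" by simp
    then show ?thesis using l(2) m(2) by (simp add: d_def)
  qed
  then show ?thesis
    unfolding ln_along_def using l by (intro the_equality) blast+
qed

definition coord1 :: "complex^2 \<Rightarrow> complex" where "coord1 u = u $ 1"
definition coord2 :: "complex^2 \<Rightarrow> complex" where "coord2 u = u $ 2"
definition coord3 :: "complex^2 \<Rightarrow> complex" where "coord3 u = 1 + u $ 1 - u $ 2"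

definition Omega :: "2 multiform2"
  where "Omega \<delta> v w = (let u = pathfinish \<delta>;
      u1 = coord1 u; u2 = coord2 u; u3 = coord3 u;
      du1 = differential coord1; du2 = differential coord2; du3 = differential coord3 in
      ln_along (coord1 \<circ> \<delta>) * (wedge du2 du3 u v w / (u2 * u3))
    - ln_along (coord2 \<circ> \<delta>) * (wedge du1 du3 u v w / (u1 * u3))
    + ln_along (coord3 \<circ> \<delta>) * (wedge du1 du2 u v w / (u1 * u2)))"


subsection \<open>The web\<close>

text \<open>The coordinates are ordered \<open>y13, y14, y24, y25, y35\<close>.\<close>

definition P :: "nat \<Rightarrow> complex^5 \<Rightarrow> complex"
  where "P k y = (let y13 = y $ 1; y14 = y $ 2; y24 = y $ 3; y25 = y $ 4; y35 = y $ 5 in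
    [1 + y25 - y24 * y35,
     1 + y13 - y14 * y35,
     1 + y24 - y14 * y25,
     1 + y35 - y13 * y25,
     1 + y14 - y13 * y24] ! (k - 1))"

definition U :: "nat \<Rightarrow> complex^5 \<Rightarrow> complex^2"
  where "U i y = (let y13 = y $ 1; y14 = y $ 2; y24 = y $ 3; y25 = y $ 4; y35 = y $ 5;
      P1 = P 1 y; P2 = P 2 y; P3 = P 3 y; P4 = P 4 y in
    [vector [y25, y24 * y35],
     vector [1 / y13, y14 * y35 / y13],
     vector [y24, y14 * y25],
     vector [1 / y35, y13 * y25 / y35],
     vector [y14, y13 * y24],
     vector [P2 / (y14 * P4), y13 * P3 / (y14 * P4)],
     vector [P1 / (y24 * P4), P3 / (y24 * P4)],
     vector [y13 * P1 / P4, P2 / P4],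
     vector [y14 * P1 / P3, y24 * P2 / P3],
     vector [P1 / (y35 * P3), y25 * P2 / (y35 * P3)]] ! (i - 1))"

definition eps :: "nat \<Rightarrow> complex"
  where "eps i = [1, -1, 1, -1, 1, 1, -1, 1, -1, 1] ! (i - 1)"

definition cube :: "(complex^5) set"
  where "cube = {y. \<forall>j. \<exists>r\<in>{0<..<1::real}. y $ j = complex_of_real r}"

text \<open>
  The locus where all the \<open>U\<^bsub>i,1\<^esub>\<close>, \<open>U\<^bsub>i,2\<^esub>\<close> and \<open>U\<^bsub>i,3\<^esub> = 1 + U\<^bsub>i,1\<^esub> - U\<^bsub>i,2\<^esub>\<close> are defined and nonzero,
  that is, where all the \<open>U\<^sub>i\<close> are defined and avoid the polar and branch locus of \<open>\<Omega>\<close>.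
  (Each factor is needed: the \<open>y\<close>'s occur as \<open>U\<^bsub>1,1\<^esub>\<close>, \<open>U\<^bsub>3,1\<^esub>\<close>, \<open>U\<^bsub>5,1\<^esub>\<close>, \<open>1/U\<^bsub>2,1\<^esub>\<close>, \<open>1/U\<^bsub>4,1\<^esub>\<close>, and
  the \<open>P\<close>'s as \<open>U\<^bsub>1,3\<^esub>\<close>, \<open>y13 U\<^bsub>2,3\<^esub>\<close>, \<open>U\<^bsub>3,3\<^esub>\<close>, \<open>y35 U\<^bsub>4,3\<^esub>\<close>, \<open>U\<^bsub>5,3\<^esub>\<close>.)
\<close>

definition regular_locus :: "(complex^5) set"
  where "regular_locus = {y. (\<forall>j. y $ j \<noteq> 0) \<and> (\<forall>k\<in>{1..5}. P k y \<noteq> 0)}"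

definition HLOG_Y5 :: "nat \<Rightarrow> 5 multiform2"
  where "HLOG_Y5 i \<gamma> v w = eps i * pullback (U i) Omega \<gamma> v w"

end

theory Submission
  imports Defs
begin

text \<open>
  Fix a path from the cube to a point \<open>y\<close> of the regular locus and two tangent vectors \<open>v, w\<close> at \<open>y\<close>.
  To a function \<open>f\<close> without zeros along the path, and positive at its start, attach the triple
  \<open>\<lambda>(f) = (ln f, dlog f(v), dlog f(w))\<close>, where \<open>ln f\<close> is continued along the path. The three terms of
  \<open>\<Omega>\<close> are the expansion along the first column of a determinant: the value of \<open>U\<^sub>i\<^sup>*\<Omega>\<close> on \<open>(v, w)\<close> is the
  determinant of the rows \<open>\<lambda>(U\<^bsub>i,1\<^esub>)\<close>, \<open>\<lambda>(U\<^bsub>i,2\<^esub>)\<close>, \<open>\<lambda>(U\<^bsub>i,3\<^esub>)\<close> (\<open>pullback_Omega\<close>).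

  Now \<open>\<lambda>\<close> turns products into sums. The logarithm does so without any correction by \<open>2\<pi>i\<close>, because
  all the functions concerned are positive at the start of the path, where the principal logarithm is
  additive, and additivity is preserved by continuation (\<open>has_log_symbol_mult\<close>,
  \<open>has_log_symbol_divide\<close>). Moreover \<open>U\<^bsub>i,3\<^esub> = 1 + U\<^bsub>i,1\<^esub> - U\<^bsub>i,2\<^esub>\<close> factors just like \<open>U\<^bsub>i,1\<^esub>\<close> and \<open>U\<^bsub>i,2\<^esub>\<close>
  do: all thirty functions are Laurent monomials in the ten letters \<open>y13, y14, y24, y25, y35\<close> and
  \<open>P\<^sub>1, ..., P\<^sub>5\<close> (\<open>coord_1_2_U\<close>, \<open>coord_3_U\<close>). In the third exterior power of the free abelian group on
  the letters one finds \<open>\<Sum>\<^sub>i \<epsilon>\<^sub>i U\<^bsub>i,1\<^esub> \<and> U\<^bsub>i,2\<^esub> \<and> U\<^bsub>i,3\<^esub> = 0\<close>, so the determinants cancel whatever the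
  values of \<open>\<lambda>\<close> on the letters are (\<open>vol_cancellation\<close>).

  For the 10-tuple to be an abelian relation, \<open>\<Omega>\<close> must moreover be the analytic continuation of a
  holomorphic form along all paths that avoid \<open>u\<^sub>1u\<^sub>2u\<^sub>3 = 0\<close>. If \<open>l\<close> is a continuous logarithm of
  \<open>u\<^sub>s\<close> along the path, a branch near the point of parameter \<open>t\<close> is \<open>l(t) + Ln (u\<^sub>s / u\<^sub>s(t))\<close>; two
  such branches for nearby parameters differ by a small number with exponential 1, hence agree
  (\<open>log_branch_locally_constant\<close>).
\<close>

section \<open>Continuous logarithms along a path\<close>

definition log_lift :: "(real \<Rightarrow> complex) \<Rightarrow> (real \<Rightarrow> complex) \<Rightarrow> bool"
  where "log_lift g l \<longleftrightarrow>
    continuous_on {0..1} l \<and> l 0 = ln (g 0) \<and> (\<forall>t\<in>{0..1}. exp (l t) = g t)"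

lemma ln_along_eq: "log_lift g l \<Longrightarrow> ln_along g = l 1"
  unfolding log_lift_def by (intro ln_along_eqI) auto

lemma log_lift_exists:
  assumes g: "continuous_on {0..1} g" and nz: "\<And>t. t \<in> {0..1} \<Longrightarrow> g t \<noteq> 0"
  obtains l where "log_lift g l"
proof -
  obtain k where k: "continuous_on {0..1} k" "\<And>t. t \<in> {0..1} \<Longrightarrow> g t = exp (k t)"
    using continuous_logarithm_on_contractible[OF g _ nz] convex_imp_contractible[of "{0..1::real}"]
    by auto
  define l where "l t = k t + (ln (g 0) - k 0)" for t
  have "exp (ln (g 0) - k 0) = 1"
    using k(2)[of 0] nz[of 0] by (simp add: exp_diff)
  then have "exp (l t) = g t" if "t \<in> {0..1}" for t
    using k(2)[OF that] by (simp add: l_def exp_add)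
  moreover have "continuous_on {0..1} l"
    unfolding l_def by (intro continuous_intros k)
  ultimately show ?thesis
    by (intro that[of l]) (simp add: log_lift_def l_def)
qed

abbreviation positive_reals :: "complex set"
  where "positive_reals \<equiv> complex_of_real ` {0<..}"

lemma positive_reals_mult: "x \<in> positive_reals \<Longrightarrow> y \<in> positive_reals \<Longrightarrow> x * y \<in> positive_reals"
  by (auto simp flip: of_real_mult)

lemma positive_reals_divide: "x \<in> positive_reals \<Longrightarrow> y \<in> positive_reals \<Longrightarrow> x / y \<in> positive_reals"
  by (auto simp flip: of_real_divide)

text \<open>
  On positive reals the principal logarithm is additive, so the sum of the two lifts starts at the
  principal logarithm of the product; this fails for arbitrary starting points.
\<close>

lemma log_lift_mult:
  assumes "log_lift f k" "log_lift g l" "f 0 \<in> positive_reals" "g 0 \<in> positive_reals"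
  shows "log_lift (\<lambda>t. f t * g t) (\<lambda>t. k t + l t)"
  using assms unfolding log_lift_def
  by (auto simp: exp_add Ln_of_real ln_mult simp flip: of_real_mult intro!: continuous_intros)

lemma log_lift_divide:
  assumes "log_lift f k" "log_lift g l" "f 0 \<in> positive_reals" "g 0 \<in> positive_reals"
  shows "log_lift (\<lambda>t. f t / g t) (\<lambda>t. k t - l t)"
  using assms unfolding log_lift_def
  by (auto simp: exp_diff Ln_of_real ln_div simp flip: of_real_divide intro!: continuous_intros)

section \<open>The logarithmic symbol of a function\<close>

text \<open>
  The triple \<open>s\<close> consists of the logarithm of \<open>f\<close> continued along \<open>\<gamma>\<close> and of the values of
  \<open>D = df / f\<close> on \<open>v\<close> and \<open>w\<close> at the end point. It is introduced as a relation so that its existence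
  need only be shown for a set of generators under multiplication.
\<close>

definition has_log_symbol ::
    "(real \<Rightarrow> complex^'n) \<Rightarrow> complex^'n \<Rightarrow> complex^'n \<Rightarrow> (complex^'n \<Rightarrow> complex)
      \<Rightarrow> complex \<times> complex \<times> complex \<Rightarrow> bool"
  where "has_log_symbol \<gamma> v w f s \<longleftrightarrow> f (\<gamma> 0) \<in> positive_reals \<and>
    (\<exists>l D. log_lift (\<lambda>t. f (\<gamma> t)) l \<and> (f has_derivative (\<lambda>h. f (\<gamma> 1) * D h)) (at (\<gamma> 1)) \<and>
      s = (l 1, D v, D w))"

lemma has_log_symbol_nonzero: "has_log_symbol \<gamma> v w f s \<Longrightarrow> f (\<gamma> 1) \<noteq> 0"
  unfolding has_log_symbol_def log_lift_def by (metis atLeastAtMost_iff exp_not_eq_zero order_refl zero_le_one)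

lemma has_log_symbol_mult:
  assumes "has_log_symbol \<gamma> v w f s" "has_log_symbol \<gamma> v w g r"
  shows "has_log_symbol \<gamma> v w (\<lambda>y. f y * g y) (s + r)"
proof -
  obtain k D l E where
    f: "f (\<gamma> 0) \<in> positive_reals" "log_lift (\<lambda>t. f (\<gamma> t)) k"
      "(f has_derivative (\<lambda>h. f (\<gamma> 1) * D h)) (at (\<gamma> 1))" "s = (k 1, D v, D w)" and
    g: "g (\<gamma> 0) \<in> positive_reals" "log_lift (\<lambda>t. g (\<gamma> t)) l"
      "(g has_derivative (\<lambda>h. g (\<gamma> 1) * E h)) (at (\<gamma> 1))" "r = (l 1, E v, E w)"
    using assms unfolding has_log_symbol_def by blast
  have "((\<lambda>y. f y * g y) has_derivative (\<lambda>h. f (\<gamma> 1) * g (\<gamma> 1) * (D h + E h))) (at (\<gamma> 1))"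
    using has_derivative_mult[OF f(3) g(3)] by (simp add: algebra_simps)
  then show ?thesis
    unfolding has_log_symbol_def
    using positive_reals_mult[OF f(1) g(1)] log_lift_mult[OF f(2) g(2) f(1) g(1)] f(4) g(4)
    by (intro conjI exI[of _ "\<lambda>t. k t + l t"] exI[of _ "\<lambda>h. D h + E h"]) auto
qed

lemma has_log_symbol_divide:
  assumes "has_log_symbol \<gamma> v w f s" "has_log_symbol \<gamma> v w g r"
  shows "has_log_symbol \<gamma> v w (\<lambda>y. f y / g y) (s - r)"
proof -
  obtain k D l E where
    f: "f (\<gamma> 0) \<in> positive_reals" "log_lift (\<lambda>t. f (\<gamma> t)) k"
      "(f has_derivative (\<lambda>h. f (\<gamma> 1) * D h)) (at (\<gamma> 1))" "s = (k 1, D v, D w)" and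
    g: "g (\<gamma> 0) \<in> positive_reals" "log_lift (\<lambda>t. g (\<gamma> t)) l"
      "(g has_derivative (\<lambda>h. g (\<gamma> 1) * E h)) (at (\<gamma> 1))" "r = (l 1, E v, E w)"
    using assms unfolding has_log_symbol_def by blast
  have nz: "g (\<gamma> 1) \<noteq> 0"
    using assms(2) by (rule has_log_symbol_nonzero)
  have "((\<lambda>y. f y / g y) has_derivative (\<lambda>h. f (\<gamma> 1) / g (\<gamma> 1) * (D h - E h))) (at (\<gamma> 1))"
    using has_derivative_divide[OF f(3) g(3) nz] nz
    by (simp add: field_simps)
  then show ?thesis
    unfolding has_log_symbol_def
    using positive_reals_divide[OF f(1) g(1)] log_lift_divide[OF f(2) g(2) f(1) g(1)] f(4) g(4)
    by (intro conjI exI[of _ "\<lambda>t. k t - l t"] exI[of _ "\<lambda>h. D h - E h"]) auto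
qed

lemma has_log_symbol_one: "has_log_symbol \<gamma> v w (\<lambda>y. 1) 0"
  unfolding has_log_symbol_def log_lift_def zero_prod_def
  by (intro conjI exI[of _ "\<lambda>t. 0"] exI[of _ "\<lambda>h. 0"]) auto

text \<open>
  Identities between rational functions hold only where the denominators do not vanish, which is an
  open set around the path.
\<close>

lemma has_log_symbol_transform:
  assumes f: "has_log_symbol \<gamma> v w f s" and S: "open S" "path_image \<gamma> \<subseteq> S"
    and eq: "\<forall>y\<in>S. g y = f y"
  shows "has_log_symbol \<gamma> v w g s"
proof -
  have \<gamma>: "\<gamma> t \<in> S" if "t \<in> {0..1}" for t
    using that S(2) by (auto simp: path_image_def)
  have "(g has_derivative D) (at (\<gamma> 1))" if "(f has_derivative D) (at (\<gamma> 1))" for D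
    by (rule has_derivative_transform_within_open[OF that S(1) \<gamma>]) (use eq in auto)
  moreover have "log_lift (\<lambda>t. g (\<gamma> t)) l" if "log_lift (\<lambda>t. f (\<gamma> t)) l" for l
    using that \<gamma> eq unfolding log_lift_def by auto
  moreover have "g (\<gamma> 0) = f (\<gamma> 0)" "g (\<gamma> 1) = f (\<gamma> 1)"
    using \<gamma> eq by auto
  ultimately show ?thesis
    using f unfolding has_log_symbol_def by metis
qed

lemma has_log_symbol_exists:
  assumes "path \<gamma>" "continuous_on (path_image \<gamma>) f" "\<And>y. y \<in> path_image \<gamma> \<Longrightarrow> f y \<noteq> 0"
    and "f (pathstart \<gamma>) \<in> positive_reals" and "f differentiable (at (pathfinish \<gamma>))"
  shows "\<exists>s. has_log_symbol \<gamma> v w f s"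
proof -
  have "continuous_on {0..1} (\<lambda>t. f (\<gamma> t))"
    using assms(1,2) continuous_on_compose2[of "path_image \<gamma>" f "{0..1}" \<gamma>]
    by (auto simp: path_def path_image_def)
  then obtain l where "log_lift (\<lambda>t. f (\<gamma> t)) l"
    using log_lift_exists assms(3) by (metis imageI path_image_def)
  moreover obtain D where D: "(f has_derivative D) (at (\<gamma> 1))"
    using assms(5) unfolding differentiable_def pathfinish_def by blast
  moreover have "f (\<gamma> 1) \<noteq> 0"
    using assms(3) by (simp add: path_image_def)
  then have "D = (\<lambda>h. f (\<gamma> 1) * (D h / f (\<gamma> 1)))"
    by auto
  ultimately show ?thesis
    using assms(4) unfolding has_log_symbol_def pathstart_def by metis
qed

section \<open>The form \<open>\<Omega>\<close> as a determinant of symbols\<close>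

text \<open>The determinant of the matrix with these three rows, expanded along the first column.\<close>

fun vol :: "complex \<times> complex \<times> complex \<Rightarrow> complex \<times> complex \<times> complex
    \<Rightarrow> complex \<times> complex \<times> complex \<Rightarrow> complex"
  where "vol (a1, b1, c1) (a2, b2, c2) (a3, b3, c3) =
    a1 * (b2 * c3 - c2 * b3) - a2 * (b1 * c3 - c1 * b3) + a3 * (b1 * c2 - c1 * b2)"

lemma has_derivative_coord:
  "(coord1 has_derivative (\<lambda>v. v $ 1)) (at u)"
  "(coord2 has_derivative (\<lambda>v. v $ 2)) (at u)"
  "(coord3 has_derivative (\<lambda>v. v $ 1 - v $ 2)) (at u)"
  unfolding coord1_def[abs_def] coord2_def[abs_def] coord3_def[abs_def]
  by (auto intro!: derivative_eq_intros bounded_linear.has_derivative[OF bounded_linear_vec_nth])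

lemma differential_coord:
  "differential coord1 u v = v $ 1"
  "differential coord2 u v = v $ 2"
  "differential coord3 u v = v $ 1 - v $ 2"
  unfolding differential_def by (simp_all flip: has_derivative_coord[THEN frechet_derivative_at])

lemma differentiable_vec2:
  fixes F :: "complex^'n \<Rightarrow> complex^2"
  assumes "(\<lambda>y. F y $ 1) differentiable (at x)" "(\<lambda>y. F y $ 2) differentiable (at x)"
  shows "F differentiable (at x)"
proof -
  have "(\<lambda>y. F y $ j) differentiable (at x)" for j
    using assms exhaust_2[of j] by auto
  then have "(\<lambda>y. F y \<bullet> b) differentiable (at x)" if "b \<in> Basis" for b
    using that unfolding differentiable_def
    by (fastforce simp: Basis_vec_def inner_axis intro: has_derivative_inner_left)
  then show ?thesis
    using differentiable_componentwise_within by blast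
qed

text \<open>
  By the chain rule \<open>du\<^sub>s / u\<^sub>s\<close>, evaluated on the image of a tangent vector under the derivative of
  \<open>F\<close>, is the logarithmic derivative of \<open>u\<^sub>s \<circ> F\<close>. Each term of \<open>\<Omega>\<close> is therefore an entry of the
  first column times the complementary minor.
\<close>

lemma pullback_Omega:
  assumes s1: "has_log_symbol \<gamma> v w (\<lambda>y. coord1 (F y)) s1"
    and s2: "has_log_symbol \<gamma> v w (\<lambda>y. coord2 (F y)) s2"
    and s3: "has_log_symbol \<gamma> v w (\<lambda>y. coord3 (F y)) s3"
  shows "pullback F Omega \<gamma> v w = vol s1 s2 s3"
proof -
  have "F differentiable (at (\<gamma> 1))"
    using s1 s2 unfolding has_log_symbol_def coord1_def coord2_def
    by (intro differentiable_vec2) (auto simp: differentiable_def)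
  then have dF: "(F has_derivative frechet_derivative F (at (\<gamma> 1))) (at (\<gamma> 1))"
    by (simp add: frechet_derivative_works)
  define u where "u = F (\<gamma> 1)"
  have symbol: "s = (ln_along (c \<circ> (F \<circ> \<gamma>)), d (frechet_derivative F (at (\<gamma> 1)) v) / c u,
      d (frechet_derivative F (at (\<gamma> 1)) w) / c u)" "c u \<noteq> 0"
    if s: "has_log_symbol \<gamma> v w (\<lambda>y. c (F y)) s" and c: "(c has_derivative d) (at u)"
    for c d s
  proof -
    obtain l D where l: "log_lift (\<lambda>t. c (F (\<gamma> t))) l" and s_eq: "s = (l 1, D v, D w)"
      and D: "((\<lambda>y. c (F y)) has_derivative (\<lambda>h. c u * D h)) (at (\<gamma> 1))"
      using s unfolding has_log_symbol_def u_def by blast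
    show nz: "c u \<noteq> 0"
      using has_log_symbol_nonzero[OF s] by (simp add: u_def)
    have "((\<lambda>y. c (F y)) has_derivative (\<lambda>h. d (frechet_derivative F (at (\<gamma> 1)) h))) (at (\<gamma> 1))"
      using has_derivative_compose[OF dF] c unfolding u_def by blast
    from has_derivative_unique[OF this D]
    have "D h = d (frechet_derivative F (at (\<gamma> 1)) h) / c u" for h
      using nz by (metis nonzero_mult_div_cancel_left)
    then show "s = (ln_along (c \<circ> (F \<circ> \<gamma>)), d (frechet_derivative F (at (\<gamma> 1)) v) / c u,
      d (frechet_derivative F (at (\<gamma> 1)) w) / c u)"
      using ln_along_eq[OF l] s_eq by (simp add: comp_def)
  qed
  note symbols = symbol[OF s1 has_derivative_coord(1)] symbol[OF s2 has_derivative_coord(2)]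
    symbol[OF s3 has_derivative_coord(3)]
  then show ?thesis
    unfolding pullback_def Let_def Omega_def wedge_def differential_coord
    by (simp add: pathfinish_def flip: u_def) (simp add: field_simps)
qed

section \<open>Functions with complex linear derivative\<close>

definition holomorphic_at :: "(complex^'n \<Rightarrow> complex) \<Rightarrow> complex^'n \<Rightarrow> bool"
  where "holomorphic_at f x \<longleftrightarrow>
    (\<exists>D. Vector_Spaces.linear (*s) (*) D \<and> (f has_derivative D) (at x))"

lemma complex_linear_iff:
  fixes D :: "complex^'n \<Rightarrow> complex"
  shows "Vector_Spaces.linear (*s) (*) D \<longleftrightarrow>
    (\<forall>x y. D (x + y) = D x + D y) \<and> (\<forall>c x. D (c *s x) = c * D x)"
  using vec.vector_space_axioms vector_space_over_itself.vector_space_axioms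
  unfolding Vector_Spaces.linear_iff by blast

lemma holomorphic_at_const: "holomorphic_at (\<lambda>x. c) x"
  unfolding holomorphic_at_def complex_linear_iff by (intro exI[of _ "\<lambda>h. 0"]) simp

lemma holomorphic_at_coord:
  "holomorphic_at coord1 u" "holomorphic_at coord2 u" "holomorphic_at coord3 u"
proof -
  have linear: "Vector_Spaces.linear (*s) (*) (\<lambda>v::complex^2. v $ 1)"
    "Vector_Spaces.linear (*s) (*) (\<lambda>v::complex^2. v $ 2)"
    "Vector_Spaces.linear (*s) (*) (\<lambda>v::complex^2. v $ 1 - v $ 2)"
    unfolding complex_linear_iff by (simp_all add: algebra_simps)
  show "holomorphic_at coord1 u" "holomorphic_at coord2 u" "holomorphic_at coord3 u"
    unfolding holomorphic_at_def using linear has_derivative_coord by blast+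
qed

lemma holomorphic_at_add:
  assumes "holomorphic_at f x" "holomorphic_at g x"
  shows "holomorphic_at (\<lambda>x. f x + g x) x"
proof -
  obtain D E where "\<forall>x y. D (x + y) = D x + D y" "\<forall>c x. D (c *s x) = c * D x"
      "(f has_derivative D) (at x)"
    "\<forall>x y. E (x + y) = E x + E y" "\<forall>c x. E (c *s x) = c * E x" "(g has_derivative E) (at x)"
    using assms unfolding holomorphic_at_def complex_linear_iff by auto
  then show ?thesis
    unfolding holomorphic_at_def complex_linear_iff
    by (intro exI[of _ "\<lambda>h. D h + E h"] conjI has_derivative_add) (simp_all add: algebra_simps)
qed

lemma holomorphic_at_mult:
  assumes "holomorphic_at f x" "holomorphic_at g x"
  shows "holomorphic_at (\<lambda>x. f x * g x) x"
proof -
  obtain D E where "\<forall>x y. D (x + y) = D x + D y" "\<forall>c x. D (c *s x) = c * D x"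
      "(f has_derivative D) (at x)"
    "\<forall>x y. E (x + y) = E x + E y" "\<forall>c x. E (c *s x) = c * E x" "(g has_derivative E) (at x)"
    using assms unfolding holomorphic_at_def complex_linear_iff by auto
  then show ?thesis
    unfolding holomorphic_at_def complex_linear_iff
    by (intro exI[of _ "\<lambda>h. f x * E h + D h * g x"] conjI has_derivative_mult)
      (simp_all add: algebra_simps)
qed

lemma holomorphic_at_compose:
  assumes "holomorphic_at f x" "(k has_field_derivative k') (at (f x))"
  shows "holomorphic_at (\<lambda>x. k (f x)) x"
proof -
  obtain D where "\<forall>x y. D (x + y) = D x + D y" "\<forall>c x. D (c *s x) = c * D x"
      "(f has_derivative D) (at x)"
    using assms unfolding holomorphic_at_def complex_linear_iff by auto
  then show ?thesis
    using has_derivative_compose[of f D x UNIV k "(*) k'"] assms(2)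
    unfolding holomorphic_at_def complex_linear_iff has_field_derivative_def
    by (intro exI[of _ "\<lambda>h. k' * D h"]) (auto simp: algebra_simps)
qed

section \<open>Branches of the logarithm near the points of a path\<close>

text \<open>The logarithm near \<open>d\<close> that takes the value \<open>l\<close> at \<open>d\<close>, if \<open>exp l = d\<close>.\<close>

definition log_branch :: "complex \<Rightarrow> complex \<Rightarrow> complex \<Rightarrow> complex"
  where "log_branch l d z = l + Ln (z / d)"

lemma log_branch_has_field_derivative:
  assumes "z / d \<notin> \<real>\<^sub>\<le>\<^sub>0"
  shows "(log_branch l d has_field_derivative inverse z) (at z)"
proof -
  have "d \<noteq> 0" "z \<noteq> 0" using assms by auto
  then show ?thesis
    unfolding log_branch_def[abs_def] using assms
    by (auto intro!: derivative_eq_intros simp: field_simps)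
qed

text \<open>
  Both branches are logarithms of \<open>z\<close>, so their difference has exponential 1 and vanishes as soon as
  its modulus is less than \<open>2\<pi>\<close>. At \<open>z = g s\<close> the difference is \<open>l s - l t - Ln (g s / g t)\<close>, which
  tends to 0 as \<open>s\<close> tends to \<open>t\<close>; for fixed \<open>s\<close> it remains small for \<open>z\<close> near \<open>g s\<close> by continuity.
\<close>

lemma log_branch_locally_constant:
  assumes l: "log_lift g l" and t: "t \<in> {0..1}"
  shows "\<forall>\<^sub>F s in at t within {0..1}. \<forall>\<^sub>F z in nhds (g s).
    log_branch (l s) (g s) z = log_branch (l t) (g t) z"
proof -
  have cont_l: "continuous_on {0..1} l" and exp_l: "\<And>s. s \<in> {0..1} \<Longrightarrow> exp (l s) = g s"
    using l unfolding log_lift_def by auto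
  have nz: "g s \<noteq> 0" if "s \<in> {0..1}" for s
    using exp_l[OF that] by (metis exp_not_eq_zero)
  have "continuous_on {0..1} g"
    by (rule continuous_on_eq[OF continuous_on_exp[OF cont_l]]) (use exp_l in auto)
  then have "(g \<longlongrightarrow> g t) (at t within {0..1})"
    using t by (simp add: continuous_on)
  then have quot: "((\<lambda>s. g s / g t) \<longlongrightarrow> 1) (at t within {0..1})"
    using tendsto_divide[OF _ tendsto_const nz[OF t]] nz[OF t] by fastforce
  have "(l \<longlongrightarrow> l t) (at t within {0..1})"
    using cont_l t by (simp add: continuous_on)
  then have "((\<lambda>s. l s - (l t + Ln (g s / g t))) \<longlongrightarrow> l t - (l t + Ln 1)) (at t within {0..1})"
    using quot by (intro tendsto_intros) auto
  then have "((\<lambda>s. norm (l s - (l t + Ln (g s / g t)))) \<longlongrightarrow> 0) (at t within {0..1})"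
    using tendsto_norm by fastforce
  then have small: "\<forall>\<^sub>F s in at t within {0..1}. norm (l s - (l t + Ln (g s / g t))) < 2 * pi"
    by (rule order_tendstoD) simp
  have slit: "\<forall>\<^sub>F s in at t within {0..1}. g s / g t \<in> - \<real>\<^sub>\<le>\<^sub>0"
    by (rule topological_tendstoD[OF quot]) (auto simp: open_Compl)
  have inside: "\<forall>\<^sub>F s in at t within {0..1}. s \<in> {0..1}"
    by (simp add: eventually_at_filter)
  show ?thesis
    using small slit inside
  proof eventually_elim
    case (elim s)
    let ?h = "\<lambda>z. log_branch (l s) (g s) z - log_branch (l t) (g t) z"
    have "isCont ?h (g s)"
      using elim nz by (intro continuous_intros
          log_branch_has_field_derivative[THEN DERIV_isCont]) auto
    then have "((\<lambda>z. norm (?h z)) \<longlongrightarrow> norm (?h (g s))) (nhds (g s))"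
      by (intro tendsto_norm) (simp add: isCont_def tendsto_nhds_iff)
    moreover have "norm (?h (g s)) < 2 * pi"
      using elim nz by (simp add: log_branch_def)
    ultimately have "\<forall>\<^sub>F z in nhds (g s). norm (?h z) < 2 * pi"
      by (rule order_tendstoD)
    moreover have "\<forall>\<^sub>F z in nhds (g s). z \<noteq> 0"
      using nz elim by (intro t1_space_nhds) auto
    ultimately show ?case
    proof eventually_elim
      case (elim z)
      have "exp (?h z) = 1"
        using elim(2) nz \<open>s \<in> {0..1}\<close> t exp_l
        by (simp add: log_branch_def exp_diff exp_add)
      then have "?h z = 0"
        using norm_ge_2pi_if_exp_eq_1 elim(1) by fastforce
      then show ?case by simp
    qed
  qed
qed

section \<open>\<open>\<Omega>\<close> as a multivalued form\<close>

text \<open>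
  \<open>\<Omega>\<close> with the three logarithms replaced by arbitrary functions. The constant factor \<open>\<kappa>\<close> takes up
  the signs \<open>\<epsilon>\<^sub>i\<close>.
\<close>

definition Omega_branch :: "complex \<Rightarrow> (complex \<Rightarrow> complex) \<Rightarrow> (complex \<Rightarrow> complex)
    \<Rightarrow> (complex \<Rightarrow> complex) \<Rightarrow> 2 form2"
  where "Omega_branch \<kappa> K1 K2 K3 u v w =
    (let du1 = differential coord1; du2 = differential coord2; du3 = differential coord3 in
     \<kappa> * (K1 (coord1 u) * (wedge du2 du3 u v w / (coord2 u * coord3 u))
      - K2 (coord2 u) * (wedge du1 du3 u v w / (coord1 u * coord3 u))
      + K3 (coord3 u) * (wedge du1 du2 u v w / (coord1 u * coord2 u))))"

text \<open>
  Here the functions \<open>log_branch l\<^sub>s d\<^sub>s\<close> of the coordinates are holomorphic, for arbitrary \<open>l\<^sub>s\<close>. With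
  \<open>d\<^sub>s = 1\<close> this is the domain of the principal logarithms, which contains the base set.
\<close>

definition slit_domain :: "complex \<Rightarrow> complex \<Rightarrow> complex \<Rightarrow> (complex^2) set"
  where "slit_domain d1 d2 d3 =
    {u. coord1 u / d1 \<notin> \<real>\<^sub>\<le>\<^sub>0 \<and> coord2 u / d2 \<notin> \<real>\<^sub>\<le>\<^sub>0 \<and> coord3 u / d3 \<notin> \<real>\<^sub>\<le>\<^sub>0}"

lemma isCont_coord: "isCont coord1 u" "isCont coord2 u" "isCont coord3 u"
  using has_derivative_coord[of u, THEN has_derivative_continuous] by auto

lemma open_slit_domain: "open (slit_domain d1 d2 d3)"
proof -
  have *: "open {u. c u / d \<notin> \<real>\<^sub>\<le>\<^sub>0}"
    if "\<And>u. isCont c u" for c :: "complex^2 \<Rightarrow> complex" and d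
  proof -
    have "continuous_on UNIV (\<lambda>u. c u / d)"
      using that unfolding divide_inverse
      by (intro continuous_intros continuous_at_imp_continuous_on) auto
    from open_vimage[OF _ this, of "- \<real>\<^sub>\<le>\<^sub>0"] show ?thesis
      by (simp add: open_Compl vimage_def)
  qed
  show ?thesis
    unfolding slit_domain_def by (intro open_Collect_conj * isCont_coord)
qed

lemma holomorphic_2form_Omega_branch:
  "holomorphic_2form (slit_domain d1 d2 d3)
    (Omega_branch \<kappa> (log_branch l1 d1) (log_branch l2 d2) (log_branch l3 d3))"
  (is "holomorphic_2form ?S ?\<omega>")
proof -
  have "holomorphic_at (\<lambda>u. ?\<omega> u v w) u" if u: "u \<in> ?S" for u v w
  proof -
    have nz: "coord1 u \<noteq> 0" "coord2 u \<noteq> 0" "coord3 u \<noteq> 0"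
      using u by (auto simp: slit_domain_def)
    have slit: "coord1 u / d1 \<notin> \<real>\<^sub>\<le>\<^sub>0" "coord2 u / d2 \<notin> \<real>\<^sub>\<le>\<^sub>0" "coord3 u / d3 \<notin> \<real>\<^sub>\<le>\<^sub>0"
      using u by (simp_all add: slit_domain_def)
    note logs = holomorphic_at_compose[OF holomorphic_at_coord(1) log_branch_has_field_derivative[OF slit(1)]]
      holomorphic_at_compose[OF holomorphic_at_coord(2) log_branch_has_field_derivative[OF slit(2)]]
      holomorphic_at_compose[OF holomorphic_at_coord(3) log_branch_has_field_derivative[OF slit(3)]]
    note inverses = holomorphic_at_compose[OF holomorphic_at_coord(1) DERIV_inverse[OF nz(1)]]
      holomorphic_at_compose[OF holomorphic_at_coord(2) DERIV_inverse[OF nz(2)]]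
      holomorphic_at_compose[OF holomorphic_at_coord(3) DERIV_inverse[OF nz(3)]]
    have expand: "?\<omega> u v w = \<kappa> * (log_branch l1 d1 (coord1 u) *
          ((v $ 2 * (w $ 1 - w $ 2) - w $ 2 * (v $ 1 - v $ 2)) * (inverse (coord2 u) * inverse (coord3 u)))
        + (- 1) * (log_branch l2 d2 (coord2 u) *
          ((v $ 1 * (w $ 1 - w $ 2) - w $ 1 * (v $ 1 - v $ 2)) * (inverse (coord1 u) * inverse (coord3 u))))
        + log_branch l3 d3 (coord3 u) *
          ((v $ 1 * w $ 2 - w $ 1 * v $ 2) * (inverse (coord1 u) * inverse (coord2 u))))" for u
      unfolding Omega_branch_def Let_def wedge_def differential_coord by (simp add: divide_inverse)
    show ?thesis
      unfolding expand
      by (intro holomorphic_at_add holomorphic_at_mult holomorphic_at_const logs inverses)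
  qed
  moreover have "Vector_Spaces.linear (*s) (*) (?\<omega> u v)"
    "Vector_Spaces.linear (*s) (*) (\<lambda>w. ?\<omega> u w v)" "?\<omega> u v v = 0" for u v
    unfolding complex_linear_iff Omega_branch_def Let_def wedge_def differential_coord
    by (simp_all add: divide_inverse algebra_simps)
  ultimately show ?thesis
    using open_slit_domain unfolding holomorphic_2form_def holomorphic_at_def by blast
qed

definition Omega_domain :: "(complex^2) set"
  where "Omega_domain = {u. coord1 u \<noteq> 0 \<and> coord2 u \<noteq> 0 \<and> coord3 u \<noteq> 0}"

lemma open_Omega_domain: "open Omega_domain"
  unfolding Omega_domain_def
  by (intro open_Collect_conj open_Collect_neq continuous_at_imp_continuous_on ballI
      isCont_coord continuous_on_const)

text \<open>
  The continuation along \<open>\<delta>\<close> is given, at time \<open>t\<close>, by the branches of the logarithms that take the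
  values \<open>l\<^sub>s t\<close> of the continuous lifts at \<open>\<delta> t\<close>. Positivity on \<open>B\<close> makes it start with the
  principal branches, for \<open>Ln (z / r) = Ln z - ln r\<close> when \<open>r > 0\<close>.
\<close>

lemma multivalued_2form_Omega:
  assumes B: "\<And>u. u \<in> B \<Longrightarrow>
    coord1 u \<in> positive_reals \<and> coord2 u \<in> positive_reals \<and> coord3 u \<in> positive_reals"
  shows "multivalued_2form Omega_domain B (\<lambda>\<delta> v w. \<kappa> * Omega \<delta> v w)"
  unfolding multivalued_2form_def
proof (rule exI[of _ "slit_domain 1 1 1"],
    rule exI[of _ "Omega_branch \<kappa> (log_branch 0 1) (log_branch 0 1) (log_branch 0 1)"],
    intro conjI allI impI)
  have positive: "z / 1 \<notin> \<real>\<^sub>\<le>\<^sub>0" if "z \<in> positive_reals" for z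
    using that by (auto simp: complex_nonpos_Reals_iff)
  show "B \<subseteq> slit_domain 1 1 1"
    unfolding slit_domain_def using B positive by blast
  let ?\<omega>0 = "Omega_branch \<kappa> (log_branch 0 1) (log_branch 0 1) (log_branch 0 1)"
  show "holomorphic_2form (slit_domain 1 1 1) ?\<omega>0"
    by (rule holomorphic_2form_Omega_branch)
  fix \<delta> :: "real \<Rightarrow> complex^2"
  assume \<delta>: "based_path Omega_domain B \<delta>"
  have inside: "\<delta> t \<in> Omega_domain" if "t \<in> {0..1}" for t
    using \<delta> that unfolding based_path_def path_image_def by blast
  have cont: "continuous_on {0..1} \<delta>"
    using \<delta> by (simp add: based_path_def path_def)
  have lift: "\<exists>l. log_lift (\<lambda>t. c (\<delta> t)) l"
    if "\<And>u. isCont c u" "\<And>u. u \<in> Omega_domain \<Longrightarrow> c u \<noteq> 0" for c :: "complex^2 \<Rightarrow> complex"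
  proof -
    have "continuous_on {0..1} (\<lambda>t. c (\<delta> t))"
      using continuous_on_compose2[of UNIV c "{0..1}" \<delta>] cont that(1)
      by (simp add: continuous_at_imp_continuous_on)
    from log_lift_exists[OF this] show ?thesis
      using that(2) inside by blast
  qed
  then obtain l1 l2 l3 where l: "log_lift (\<lambda>t. coord1 (\<delta> t)) l1"
    "log_lift (\<lambda>t. coord2 (\<delta> t)) l2" "log_lift (\<lambda>t. coord3 (\<delta> t)) l3"
    using lift[OF isCont_coord(1)] lift[OF isCont_coord(2)] lift[OF isCont_coord(3)]
    unfolding Omega_domain_def by auto
  define V where "V t = slit_domain (coord1 (\<delta> t)) (coord2 (\<delta> t)) (coord3 (\<delta> t))" for t
  define \<theta> where "\<theta> t = Omega_branch \<kappa> (log_branch (l1 t) (coord1 (\<delta> t)))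
    (log_branch (l2 t) (coord2 (\<delta> t))) (log_branch (l3 t) (coord3 (\<delta> t)))" for t
  have coord_lim: "filterlim coord1 (nhds (coord1 u)) (nhds u)"
    "filterlim coord2 (nhds (coord2 u)) (nhds u)"
    "filterlim coord3 (nhds (coord3 u)) (nhds u)" for u
    using isCont_coord[of u] by (simp_all add: isCont_def tendsto_nhds_iff)
  show "\<exists>V \<theta>. (\<forall>t\<in>{0..1}. \<delta> t \<in> V t \<and> holomorphic_2form (V t) (\<theta> t)) \<and>
      (\<forall>\<^sub>F x in nhds (\<delta> 0). \<theta> 0 x = ?\<omega>0 x) \<and>
      (\<forall>t\<in>{0..1}. \<forall>\<^sub>F s in at t within {0..1}. \<forall>\<^sub>F x in nhds (\<delta> s). \<theta> s x = \<theta> t x) \<and>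
      (\<lambda>v w. \<kappa> * Omega \<delta> v w) = \<theta> 1 (\<delta> 1)"
  proof (intro exI[of _ V] exI[of _ \<theta>] conjI ballI)
    fix t :: real assume t: "t \<in> {0..1}"
    show "\<delta> t \<in> V t"
      using inside[OF t] by (simp add: V_def slit_domain_def Omega_domain_def)
    show "holomorphic_2form (V t) (\<theta> t)"
      unfolding V_def \<theta>_def by (rule holomorphic_2form_Omega_branch)
    show "\<forall>\<^sub>F s in at t within {0..1}. \<forall>\<^sub>F x in nhds (\<delta> s). \<theta> s x = \<theta> t x"
      using l[THEN log_branch_locally_constant[OF _ t]]
    proof eventually_elim
      case (elim s)
      have "\<forall>\<^sub>F x in nhds (\<delta> s).
          log_branch (l1 s) (coord1 (\<delta> s)) (coord1 x) = log_branch (l1 t) (coord1 (\<delta> t)) (coord1 x)"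
        "\<forall>\<^sub>F x in nhds (\<delta> s).
          log_branch (l2 s) (coord2 (\<delta> s)) (coord2 x) = log_branch (l2 t) (coord2 (\<delta> t)) (coord2 x)"
        "\<forall>\<^sub>F x in nhds (\<delta> s).
          log_branch (l3 s) (coord3 (\<delta> s)) (coord3 x) = log_branch (l3 t) (coord3 (\<delta> t)) (coord3 x)"
        using eventually_compose_filterlim[OF elim(1) coord_lim(1)]
          eventually_compose_filterlim[OF elim(2) coord_lim(2)]
          eventually_compose_filterlim[OF elim(3) coord_lim(3)]
        by simp_all
      then show ?case
        by eventually_elim (simp add: \<theta>_def Omega_branch_def fun_eq_iff)
    qed
  next
    have principal: "log_branch (l 0) (c (\<delta> 0)) z = log_branch 0 1 z"
      if "log_lift (\<lambda>t. c (\<delta> t)) l" "c (\<delta> 0) \<in> positive_reals" "z \<noteq> 0" for c l z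
      using that by (auto simp: log_branch_def log_lift_def Ln_of_real Ln_divide_of_real)
    have start: "\<delta> 0 \<in> B"
      using \<delta> by (simp add: based_path_def pathstart_def)
    have "\<forall>\<^sub>F x in nhds (\<delta> 0). x \<in> Omega_domain"
      using open_Omega_domain inside by (intro eventually_nhds_in_open) auto
    then show "\<forall>\<^sub>F x in nhds (\<delta> 0). \<theta> 0 x = ?\<omega>0 x"
    proof eventually_elim
      case (elim x)
      then show ?case
        using principal[OF l(1)] principal[OF l(2)] principal[OF l(3)] B[OF start]
        by (simp add: \<theta>_def Omega_branch_def Omega_domain_def fun_eq_iff)
    qed
  next
    have final: "log_branch (l 1) (c (\<delta> 1)) (c (\<delta> 1)) = ln_along (c \<circ> \<delta>)"
      if "log_lift (\<lambda>t. c (\<delta> t)) l" "c (\<delta> 1) \<noteq> 0" for c l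
      using that ln_along_eq[OF that(1)] by (simp add: log_branch_def comp_def)
    show "(\<lambda>v w. \<kappa> * Omega \<delta> v w) = \<theta> 1 (\<delta> 1)"
      using final[OF l(1)] final[OF l(2)] final[OF l(3)] inside[of 1]
      by (simp add: \<theta>_def Omega_branch_def Omega_def Let_def pathfinish_def Omega_domain_def fun_eq_iff)
  qed
qed

section \<open>The cancellation in the exterior cube\<close>

text \<open>
  Here \<open>a, ..., e\<close> are the symbols of \<open>y13, y14, y24, y25, y35\<close> and \<open>p1, ..., p5\<close> those of the
  \<open>P\<^sub>k\<close>, and the rows record the exponents in the factorizations of the \<open>U\<^bsub>i,s\<^esub>\<close>. Since a determinant is
  trilinear and alternating, this is the identity \<open>\<Sum>\<^sub>i \<epsilon>\<^sub>i U\<^bsub>i,1\<^esub> \<and> U\<^bsub>i,2\<^esub> \<and> U\<^bsub>i,3\<^esub> = 0\<close> of formal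
  products; it is verified by expansion. The zero in \<open>0 - a\<close> is the symbol of the numerator 1.
\<close>

lemma vol_cancellation:
  "vol d (c + e) p1
    - vol (0 - a) (b + e - a) (p2 - a)
    + vol c (b + d) p3
    - vol (0 - e) (a + d - e) (p4 - e)
    + vol b (a + c) p5
    + vol (p2 - (b + p4)) (a + p3 - (b + p4)) (p5 - (b + p4))
    - vol (p1 - (c + p4)) (p3 - (c + p4)) (d + p5 - (c + p4))
    + vol (a + p1 - p4) (p2 - p4) (e + p5 - p4)
    - vol (b + p1 - p3) (c + p2 - p3) (p5 - p3)
    + vol (p1 - (e + p3)) (d + p2 - (e + p3)) (p4 - (e + p3)) = 0"
  by (cases a; cases b; cases c; cases d; cases e; cases p1; cases p2; cases p3; cases p4; cases p5)
    (simp add: zero_prod_def algebra_simps)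

section \<open>The letters and the factorizations of the first integrals\<close>

lemma P_eqs:
  "P 1 y = 1 + y $ 4 - y $ 3 * y $ 5"
  "P 2 y = 1 + y $ 1 - y $ 2 * y $ 5"
  "P 3 y = 1 + y $ 3 - y $ 2 * y $ 4"
  "P 4 y = 1 + y $ 5 - y $ 1 * y $ 4"
  "P 5 y = 1 + y $ 2 - y $ 1 * y $ 3"
  by (simp_all add: P_def Let_def)

lemma atLeastAtMost_1_5: "{1..5::nat} = {1, 2, 3, 4, 5}"
  by auto

lemma atLeastAtMost_1_10: "{1..10::nat} = {1, 2, 3, 4, 5, 6, 7, 8, 9, 10}"
  by auto presburger

lemma differentiable_nth: "(\<lambda>y::complex^5. y $ j) differentiable (at x)"
  using bounded_linear.has_derivative[OF bounded_linear_vec_nth has_derivative_ident]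
  unfolding differentiable_def by blast

lemma differentiable_P:
  assumes "k \<in> {1..5}"
  shows "P k differentiable (at x)"
  using assms unfolding atLeastAtMost_1_5
  by (auto simp: P_eqs[abs_def] simp del: One_nat_def intro!: derivative_intros differentiable_nth)

lemma continuous_on_P: "k \<in> {1..5} \<Longrightarrow> continuous_on S (P k)"
  using differentiable_P differentiable_imp_continuous_within
  by (blast intro: continuous_at_imp_continuous_on)

lemma open_regular_locus: "open regular_locus"
proof -
  have eq: "regular_locus = (\<Inter>j. {y. y $ j \<noteq> 0}) \<inter> (\<Inter>k\<in>{1..5}. {y. P k y \<noteq> 0})"
    by (auto simp: regular_locus_def)
  have "open {y::complex^5. y $ j \<noteq> 0}" for j
    by (intro open_Collect_neq continuous_intros)
  moreover have "open {y. P k y \<noteq> 0}" if "k \<in> {1..5}" for k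
    using that by (intro open_Collect_neq continuous_on_P continuous_on_const)
  ultimately show ?thesis
    unfolding eq by (intro open_Int open_INT) auto
qed

text \<open>A polynomial \<open>P\<^sub>k\<close> has the form \<open>1 + a - b c\<close> with \<open>a > 0\<close> and \<open>b c < 1\<close> on the cube.\<close>

lemma cube_positive:
  assumes "y \<in> cube"
  shows "y $ j \<in> positive_reals" "k \<in> {1..5} \<Longrightarrow> P k y \<in> positive_reals"
proof -
  have "\<forall>j. \<exists>r. y $ j = complex_of_real r \<and> 0 < r \<and> r < 1"
    using assms by (fastforce simp: cube_def)
  then obtain r where r: "\<And>j. y $ j = complex_of_real (r j)" "\<And>j. 0 < r j" "\<And>j. r j < 1"
    by metis
  show "y $ j \<in> positive_reals"
    using r by auto
  have "1 + complex_of_real (r a) - complex_of_real (r b) * complex_of_real (r c) \<in> positive_reals"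
    for a b c
  proof -
    have "r b * r c < 1 * 1"
      using r by (intro mult_strict_mono) (auto intro: less_imp_le)
    then have "0 < 1 + r a - r b * r c"
      using r(2)[of a] by simp
    then show ?thesis
      by (intro image_eqI[of _ _ "1 + r a - r b * r c"]) simp_all
  qed
  then show "P k y \<in> positive_reals" if "k \<in> {1..5}"
    using that unfolding atLeastAtMost_1_5 by (auto simp: P_eqs r(1) simp del: One_nat_def) 
qed

lemma coord_1_2_U:
  "\<forall>y\<in>regular_locus. coord1 (U 1 y) = y $ 4"
  "\<forall>y\<in>regular_locus. coord2 (U 1 y) = y $ 3 * y $ 5"
  "\<forall>y\<in>regular_locus. coord1 (U 2 y) = 1 / y $ 1"
  "\<forall>y\<in>regular_locus. coord2 (U 2 y) = y $ 2 * y $ 5 / y $ 1"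
  "\<forall>y\<in>regular_locus. coord1 (U 3 y) = y $ 3"
  "\<forall>y\<in>regular_locus. coord2 (U 3 y) = y $ 2 * y $ 4"
  "\<forall>y\<in>regular_locus. coord1 (U 4 y) = 1 / y $ 5"
  "\<forall>y\<in>regular_locus. coord2 (U 4 y) = y $ 1 * y $ 4 / y $ 5"
  "\<forall>y\<in>regular_locus. coord1 (U 5 y) = y $ 2"
  "\<forall>y\<in>regular_locus. coord2 (U 5 y) = y $ 1 * y $ 3"
  "\<forall>y\<in>regular_locus. coord1 (U 6 y) = P 2 y / (y $ 2 * P 4 y)"
  "\<forall>y\<in>regular_locus. coord2 (U 6 y) = y $ 1 * P 3 y / (y $ 2 * P 4 y)"
  "\<forall>y\<in>regular_locus. coord1 (U 7 y) = P 1 y / (y $ 3 * P 4 y)"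
  "\<forall>y\<in>regular_locus. coord2 (U 7 y) = P 3 y / (y $ 3 * P 4 y)"
  "\<forall>y\<in>regular_locus. coord1 (U 8 y) = y $ 1 * P 1 y / P 4 y"
  "\<forall>y\<in>regular_locus. coord2 (U 8 y) = P 2 y / P 4 y"
  "\<forall>y\<in>regular_locus. coord1 (U 9 y) = y $ 2 * P 1 y / P 3 y"
  "\<forall>y\<in>regular_locus. coord2 (U 9 y) = y $ 3 * P 2 y / P 3 y"
  "\<forall>y\<in>regular_locus. coord1 (U 10 y) = P 1 y / (y $ 5 * P 3 y)"
  "\<forall>y\<in>regular_locus. coord2 (U 10 y) = y $ 4 * P 2 y / (y $ 5 * P 3 y)"
  by (simp_all add: U_def Let_def coord1_def coord2_def)

lemma one_plus_fractions:
  fixes d x y z :: complex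
  assumes "d \<noteq> 0" "d + x - y = z"
  shows "1 + x / d - y / d = z / d"
  using assms by (auto simp: field_simps)

lemma regular_locus_nonzero:
  assumes "y \<in> regular_locus"
  shows "y $ j \<noteq> 0" "P 1 y \<noteq> 0" "P 2 y \<noteq> 0" "P 3 y \<noteq> 0" "P 4 y \<noteq> 0" "P 5 y \<noteq> 0"
  using assms by (auto simp: regular_locus_def)

text \<open>
  Over the common denominator of \<open>U\<^bsub>i,1\<^esub>\<close> and \<open>U\<^bsub>i,2\<^esub>\<close>, the numerator of \<open>1 + U\<^bsub>i,1\<^esub> - U\<^bsub>i,2\<^esub>\<close> is again a
  product of letters; for instance \<open>y14 P\<^sub>4 + P\<^sub>2 - y13 P\<^sub>3 = P\<^sub>5\<close> when \<open>i = 6\<close> and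
  \<open>y24 P\<^sub>4 + P\<^sub>1 - P\<^sub>3 = y25 P\<^sub>5\<close> when \<open>i = 7\<close>.
\<close>

lemma coord_3_U:
  "\<forall>y\<in>regular_locus. coord3 (U 1 y) = P 1 y"
  "\<forall>y\<in>regular_locus. coord3 (U 2 y) = P 2 y / y $ 1"
  "\<forall>y\<in>regular_locus. coord3 (U 3 y) = P 3 y"
  "\<forall>y\<in>regular_locus. coord3 (U 4 y) = P 4 y / y $ 5"
  "\<forall>y\<in>regular_locus. coord3 (U 5 y) = P 5 y"
  "\<forall>y\<in>regular_locus. coord3 (U 6 y) = P 5 y / (y $ 2 * P 4 y)"
  "\<forall>y\<in>regular_locus. coord3 (U 7 y) = y $ 4 * P 5 y / (y $ 3 * P 4 y)"
  "\<forall>y\<in>regular_locus. coord3 (U 8 y) = y $ 5 * P 5 y / P 4 y"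
  "\<forall>y\<in>regular_locus. coord3 (U 9 y) = P 5 y / P 3 y"
  "\<forall>y\<in>regular_locus. coord3 (U 10 y) = P 4 y / (y $ 5 * P 3 y)"
proof -
  show "\<forall>y\<in>regular_locus. coord3 (U 1 y) = P 1 y"
    by (simp add: U_def Let_def coord3_def P_eqs del: One_nat_def)
  show "\<forall>y\<in>regular_locus. coord3 (U 2 y) = P 2 y / y $ 1"
    by (simp add: U_def Let_def coord3_def del: One_nat_def, intro ballI one_plus_fractions)
      (simp add: regular_locus_nonzero, simp add: P_eqs algebra_simps del: One_nat_def)
  show "\<forall>y\<in>regular_locus. coord3 (U 3 y) = P 3 y"
    by (simp add: U_def Let_def coord3_def P_eqs del: One_nat_def)
  show "\<forall>y\<in>regular_locus. coord3 (U 4 y) = P 4 y / y $ 5"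
    by (simp add: U_def Let_def coord3_def del: One_nat_def, intro ballI one_plus_fractions)
      (simp add: regular_locus_nonzero, simp add: P_eqs algebra_simps del: One_nat_def)
  show "\<forall>y\<in>regular_locus. coord3 (U 5 y) = P 5 y"
    by (simp add: U_def Let_def coord3_def P_eqs del: One_nat_def)
  show "\<forall>y\<in>regular_locus. coord3 (U 6 y) = P 5 y / (y $ 2 * P 4 y)"
    by (simp add: U_def Let_def coord3_def del: One_nat_def, intro ballI one_plus_fractions)
      (simp add: regular_locus_nonzero, simp add: P_eqs algebra_simps del: One_nat_def)
  show "\<forall>y\<in>regular_locus. coord3 (U 7 y) = y $ 4 * P 5 y / (y $ 3 * P 4 y)"
    by (simp add: U_def Let_def coord3_def del: One_nat_def, intro ballI one_plus_fractions)
      (simp add: regular_locus_nonzero, simp add: P_eqs algebra_simps del: One_nat_def)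
  show "\<forall>y\<in>regular_locus. coord3 (U 8 y) = y $ 5 * P 5 y / P 4 y"
    by (simp add: U_def Let_def coord3_def del: One_nat_def, intro ballI one_plus_fractions)
      (simp add: regular_locus_nonzero, simp add: P_eqs algebra_simps del: One_nat_def)
  show "\<forall>y\<in>regular_locus. coord3 (U 9 y) = P 5 y / P 3 y"
    by (simp add: U_def Let_def coord3_def del: One_nat_def, intro ballI one_plus_fractions)
      (simp add: regular_locus_nonzero, simp add: P_eqs algebra_simps del: One_nat_def)
  show "\<forall>y\<in>regular_locus. coord3 (U 10 y) = P 4 y / (y $ 5 * P 3 y)"
    by (simp add: U_def Let_def coord3_def del: One_nat_def, intro ballI one_plus_fractions)
      (simp add: regular_locus_nonzero, simp add: P_eqs algebra_simps del: One_nat_def)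
qed

lemmas coord_U = coord_1_2_U coord_3_U

lemma U_in_Omega_domain:
  assumes i: "i \<in> {1..10}" and y: "y \<in> regular_locus"
  shows "U i y \<in> Omega_domain"
proof -
  have "coord1 (U i y) \<noteq> 0 \<and> coord2 (U i y) \<noteq> 0 \<and> coord3 (U i y) \<noteq> 0"
    using i unfolding atLeastAtMost_1_10
    by (elim insertE emptyE; simp only: coord_U[THEN bspec, OF y])
      (use regular_locus_nonzero[OF y] in simp_all)
  then show ?thesis
    by (simp add: Omega_domain_def)
qed

lemma cube_subset_regular_locus: "cube \<subseteq> regular_locus"
proof
  fix y assume "y \<in> cube"
  note positive = cube_positive[OF this]
  have "z \<noteq> 0" if "z \<in> positive_reals" for z
    using that by auto
  then show "y \<in> regular_locus"
    unfolding regular_locus_def using positive by blast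
qed

lemma U_positive:
  assumes "i \<in> {1..10}" "y \<in> cube"
  shows "coord1 (U i y) \<in> positive_reals \<and> coord2 (U i y) \<in> positive_reals \<and> coord3 (U i y) \<in> positive_reals"
proof -
  have letters: "1 \<in> positive_reals" "y $ j \<in> positive_reals" "P 1 y \<in> positive_reals"
    "P 2 y \<in> positive_reals" "P 3 y \<in> positive_reals" "P 4 y \<in> positive_reals"
    "P 5 y \<in> positive_reals" for j
    using cube_positive[OF assms(2)] by (auto simp: image_iff)
  have y: "y \<in> regular_locus"
    using assms(2) cube_subset_regular_locus by blast
  show ?thesis
    using assms(1) unfolding atLeastAtMost_1_10
    by (elim insertE emptyE; simp only: coord_U[THEN bspec, OF y])
      (intro conjI positive_reals_mult positive_reals_divide letters)+
qed

section \<open>The relation \<open>HLOG\<close>\<close>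

lemma sum_pullback_Omega:
  assumes \<gamma>: "path \<gamma>" "path_image \<gamma> \<subseteq> regular_locus" "pathstart \<gamma> \<in> cube"
  shows "(\<Sum>i=1..10. eps i * pullback (U i) Omega \<gamma> v w) = 0"
proof -
  have "\<exists>t. has_log_symbol \<gamma> v w (\<lambda>y. y $ j) t" for j
    using \<gamma> cube_positive(1)
    by (intro has_log_symbol_exists continuous_intros differentiable_nth)
      (auto simp: regular_locus_def)
  then obtain s where s: "\<And>j. has_log_symbol \<gamma> v w (\<lambda>y. y $ j) (s j)"
    by metis
  have "\<exists>t. has_log_symbol \<gamma> v w (P k) t" if "k \<in> {1..5}" for k
    using \<gamma> cube_positive(2) that
    by (intro has_log_symbol_exists continuous_on_P differentiable_P)
      (auto simp: regular_locus_def)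
  then obtain p where p: "\<And>k. k \<in> {1..5} \<Longrightarrow> has_log_symbol \<gamma> v w (P k) (p k)"
    by metis
  have p': "has_log_symbol \<gamma> v w (P 1) (p 1)" "has_log_symbol \<gamma> v w (P 2) (p 2)"
    "has_log_symbol \<gamma> v w (P 3) (p 3)" "has_log_symbol \<gamma> v w (P 4) (p 4)"
    "has_log_symbol \<gamma> v w (P 5) (p 5)"
    by (intro p; simp)+
  \<comment> \<open>Each symbol below is read off from the factorization of the corresponding function.\<close>
  note transform = has_log_symbol_transform[OF _ open_regular_locus \<gamma>(2)]
  have
    "pullback (U 1) Omega \<gamma> v w = vol (s 4) (s 3 + s 5) (p 1)"
    "pullback (U 2) Omega \<gamma> v w = vol (0 - s 1) (s 2 + s 5 - s 1) (p 2 - s 1)"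
    "pullback (U 3) Omega \<gamma> v w = vol (s 3) (s 2 + s 4) (p 3)"
    "pullback (U 4) Omega \<gamma> v w = vol (0 - s 5) (s 1 + s 4 - s 5) (p 4 - s 5)"
    "pullback (U 5) Omega \<gamma> v w = vol (s 2) (s 1 + s 3) (p 5)"
    "pullback (U 6) Omega \<gamma> v w = vol (p 2 - (s 2 + p 4)) (s 1 + p 3 - (s 2 + p 4)) (p 5 - (s 2 + p 4))"
    "pullback (U 7) Omega \<gamma> v w = vol (p 1 - (s 3 + p 4)) (p 3 - (s 3 + p 4)) (s 4 + p 5 - (s 3 + p 4))"
    "pullback (U 8) Omega \<gamma> v w = vol (s 1 + p 1 - p 4) (p 2 - p 4) (s 5 + p 5 - p 4)"
    "pullback (U 9) Omega \<gamma> v w = vol (s 2 + p 1 - p 3) (s 3 + p 2 - p 3) (p 5 - p 3)"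
    "pullback (U 10) Omega \<gamma> v w = vol (p 1 - (s 5 + p 3)) (s 4 + p 2 - (s 5 + p 3)) (p 4 - (s 5 + p 3))"
    by (intro pullback_Omega coord_U[THEN transform[rotated]] has_log_symbol_mult
        has_log_symbol_divide has_log_symbol_one s p')+
  then have "(\<Sum>i=1..10. eps i * pullback (U i) Omega \<gamma> v w) =
      vol (s 4) (s 3 + s 5) (p 1)
      - vol (0 - s 1) (s 2 + s 5 - s 1) (p 2 - s 1)
      + vol (s 3) (s 2 + s 4) (p 3)
      - vol (0 - s 5) (s 1 + s 4 - s 5) (p 4 - s 5)
      + vol (s 2) (s 1 + s 3) (p 5)
      + vol (p 2 - (s 2 + p 4)) (s 1 + p 3 - (s 2 + p 4)) (p 5 - (s 2 + p 4))
      - vol (p 1 - (s 3 + p 4)) (p 3 - (s 3 + p 4)) (s 4 + p 5 - (s 3 + p 4))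
      + vol (s 1 + p 1 - p 4) (p 2 - p 4) (s 5 + p 5 - p 4)
      - vol (s 2 + p 1 - p 3) (s 3 + p 2 - p 3) (p 5 - p 3)
      + vol (p 1 - (s 5 + p 3)) (s 4 + p 2 - (s 5 + p 3)) (p 4 - (s 5 + p 3))"
    unfolding atLeastAtMost_1_10 by (simp add: eps_def)
  then show ?thesis
    by (simp only: vol_cancellation)
qed

theorem proposition3p4:
  fixes \<U> :: "(complex^5) set"
  assumes "open \<U>" and "connected \<U>" and "cube \<subseteq> \<U>"
  shows "(\<forall>\<gamma> v w. based_path (\<U> \<inter> regular_locus) cube \<gamma> \<longrightarrow>
            (\<Sum>i=1..10. eps i * pullback (U i) Omega \<gamma> v w) = 0) \<and>
         abelian_relation_2 (\<U> \<inter> regular_locus) cube {1..10} U HLOG_Y5"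
proof -
  let ?M = "\<U> \<inter> regular_locus"
  have sum: "(\<Sum>i=1..10. eps i * pullback (U i) Omega \<gamma> v w) = 0"
    if "based_path ?M cube \<gamma>" for \<gamma> v w
    using that by (intro sum_pullback_Omega) (auto simp: based_path_def)
  have "\<exists>X \<omega>. open X \<and> U i ` ?M \<subseteq> X \<and> multivalued_2form X (U i ` cube) \<omega> \<and>
      (\<forall>\<gamma>. based_path ?M cube \<gamma> \<longrightarrow> HLOG_Y5 i \<gamma> = pullback (U i) \<omega> \<gamma>)"
    if i: "i \<in> {1..10}" for i
  proof (intro exI conjI allI impI)
    show "open Omega_domain"
      by (rule open_Omega_domain)
    show "U i ` ?M \<subseteq> Omega_domain"
      using U_in_Omega_domain[OF i] by blast
    show "multivalued_2form Omega_domain (U i ` cube) (\<lambda>\<delta> v w. eps i * Omega \<delta> v w)"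
      using U_positive[OF i] by (intro multivalued_2form_Omega) blast
    show "HLOG_Y5 i \<gamma> = pullback (U i) (\<lambda>\<delta> v w. eps i * Omega \<delta> v w) \<gamma>" for \<gamma>
      by (simp add: fun_eq_iff HLOG_Y5_def pullback_def Let_def)
  qed
  then show ?thesis
    using sum unfolding abelian_relation_2_def HLOG_Y5_def by auto
qed

end
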